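(* Let $\mathcal{S}$ be a finite lattice semiring. For any $\mathcal{S}$-interpretations $\pi_A,\pi_B$, tuples $\bar a\in A^n$, $\bar b\in B^n$ and $m\in\mathbb{N}$, the following are equivalent: (1) Duplicator has a winning strategy in $HG^f_m(\pi_A,\bar a,\pi_B,\bar b)$; (2) for each $s\in idc(\mathcal{S})$: $\pi_B[\![\chi^{m,s}_{\pi_A,\bar a}(\bar b)]\!]+s=\pi_B[\![\chi^{m,s}_{\pi_A,\bar a}(\bar b)]\!]$ and $\pi_A[\![\chi^{m,s}_{\pi_B,\bar b}(\bar a)]\!]+s=\pi_A[\![\chi^{m,s}_{\pi_B,\bar b}(\bar a)]\!]$; (3) $(\pi_A,\bar a)\equiv_m(\pi_B,\bar b)$. In particular, $HG^f_m$ is sound and complete for $\equiv_m$ on $\mathcal{S}$.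
   Context: A lattice semiring is a (commutative, naturally ordered) semiring $\mathcal{S}=(S,+,\cdot,0,1)$ that is fully idempotent ($s+s=s=s\cdot s$) and absorptive ($s+st=s$). A non-zero $s$ is $+$-indecomposable if there are no $r,t$ with $r\ne s$, $t\ne s$, $r+t=s$; $idc(\mathcal{S})$ denotes the set of these. For a finite relational vocabulary $\tau$, an $\mathcal{S}$-interpretation maps the literals $R\bar a,\neg R\bar a$ over its universe to $S$; formulae in negation normal form are evaluated with equalities by truth value, literals by $\pi$, $\vee,\exists$ as sums, $\wedge,\forall$ as products over the universe (infinite ones being finite by idempotence, as $S$ is finite); $\equiv_m$: equal values for all formulae of quantifier rank $\le m$. Game $HG^f_m(\pi_A,\bar a,\pi_B,\bar b)$: Spoiler first chooses $s\in idc(\mathcal{S})$ and either $(\pi_0,\bar c,\pi_1,\bar d)=(\pi_A,\bar a,\pi_B,\bar b)$ or $(\pi_B,\bar b,\pi_A,\bar a)$; then in $m$ rounds Spoiler picks an element of one universe and Duplicator of the other. With final tuples $\bar c',\bar d'$, Duplicator wins iff they have the same equality pattern and for every $\tau$-literal $L(\bar x)$, $\pi_0(L(\bar c'))+s=\pi_0(L(\bar c'))$ implies $\pi_1(L(\bar d'))+s=\pi_1(L(\bar d'))$. Characteristic formulae for $\pi$ with universe $C$, $\bar c\in C^n$, $s\in idc(\mathcal{S})$: $\varphi^=_{\bar c}(\bar x)$ is the conjunction of $x_i=x_j$ ($c_i=c_j$) and $x_i\ne x_j$ ($c_i\ne c_j$); $\chi^{0,s}_{\pi,\bar c}(\bar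 x)=\varphi^=_{\bar c}(\bar x)\wedge\bigwedge\{L(\bar x):\pi(L(\bar c))+s=\pi(L(\bar c))\}$ ($L$ over $\tau$-literals in $x_1,\dots,x_n$); $\chi^{m+1,s}_{\pi,\bar c}(\bar x)=\bigwedge_{c\in C}\exists x\,\chi^{m,s}_{\pi,\bar c c}(\bar x,x)\wedge\forall x\bigvee_{c\in C}\chi^{m,s}_{\pi,\bar c c}(\bar x,x)$ (over the finitely many distinct formulae). *)

theory Defs
  imports Main
begin

text \<open>
  The library class \<open>canonically_ordered_monoid_add\<close> says that the natural preorder
  \<open>\<exists>c. b = a + c\<close> is a partial order.  The condition \<open>0 \<noteq> 1\<close> (which would turn
  the base into \<open>comm_semiring_1\<close>) is not imposed.
\<close>

class lattice_semiring = comm_semiring_0 + comm_monoid_mult + canonically_ordered_monoid_add +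
  assumes add_idem: "s + s = s"
    and mult_idem: "s * s = s"
    and absorptive: "s + s * t = s"

definition idc :: "'s::lattice_semiring set" where
  "idc = {s. s \<noteq> 0 \<and> \<not> (\<exists>r t. r \<noteq> s \<and> t \<noteq> s \<and> r + t = s)}"

text \<open>
  A finite relational vocabulary is a finite set \<open>\<tau>\<close> of symbols with an arity function \<open>ar\<close>.
  The type \<open>'v\<close> in a literal is either a universe or the type of variables.
\<close>

datatype (dead 'r, 'v) lit = PosL 'r "'v list" | NegL 'r "'v list"

definition lits_over :: "'r set \<Rightarrow> ('r \<Rightarrow> nat) \<Rightarrow> 'v set \<Rightarrow> ('r, 'v) lit set" where
  "lits_over \<tau> ar V =
     {PosL R xs | R xs. R \<in> \<tau> \<and> length xs = ar R \<and> set xs \<subseteq> V} \<union>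
     {NegL R xs | R xs. R \<in> \<tau> \<and> length xs = ar R \<and> set xs \<subseteq> V}"

text \<open>
  The universe of an interpretation is the type \<open>'a\<close>.  Values at literals outside
  \<open>lits_over \<tau> ar UNIV\<close> are never inspected.
\<close>

type_synonym ('r, 'a, 's) interp = "('r, 'a) lit \<Rightarrow> 's"

text \<open>
  Formulae in negation normal form; variables are natural numbers.  The constants \<open>Tru\<close> and
  \<open>Fls\<close> serve as the empty conjunction and disjunction.
\<close>

datatype 'r fm =
    Tru
  | Fls
  | Eq nat nat
  | Neq nat nat
  | Lit "('r, nat) lit"
  | And "'r fm" "'r fm"
  | Or "'r fm" "'r fm"
  | Ex nat "'r fm"
  | All nat "'r fm"

primrec wf_fm :: "'r set \<Rightarrow> ('r \<Rightarrow> nat) \<Rightarrow> 'r fm \<Rightarrow> bool" where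
  "wf_fm \<tau> ar Tru \<longleftrightarrow> True"
| "wf_fm \<tau> ar Fls \<longleftrightarrow> True"
| "wf_fm \<tau> ar (Eq x y) \<longleftrightarrow> True"
| "wf_fm \<tau> ar (Neq x y) \<longleftrightarrow> True"
| "wf_fm \<tau> ar (Lit L) \<longleftrightarrow> L \<in> lits_over \<tau> ar UNIV"
| "wf_fm \<tau> ar (And \<phi> \<psi>) \<longleftrightarrow> wf_fm \<tau> ar \<phi> \<and> wf_fm \<tau> ar \<psi>"
| "wf_fm \<tau> ar (Or \<phi> \<psi>) \<longleftrightarrow> wf_fm \<tau> ar \<phi> \<and> wf_fm \<tau> ar \<psi>"
| "wf_fm \<tau> ar (Ex x \<phi>) \<longleftrightarrow> wf_fm \<tau> ar \<phi>"
| "wf_fm \<tau> ar (All x \<phi>) \<longleftrightarrow> wf_fm \<tau> ar \<phi>"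

primrec fv :: "'r fm \<Rightarrow> nat set" where
  "fv Tru = {}"
| "fv Fls = {}"
| "fv (Eq x y) = {x, y}"
| "fv (Neq x y) = {x, y}"
| "fv (Lit L) = set_lit L"
| "fv (And \<phi> \<psi>) = fv \<phi> \<union> fv \<psi>"
| "fv (Or \<phi> \<psi>) = fv \<phi> \<union> fv \<psi>"
| "fv (Ex x \<phi>) = fv \<phi> - {x}"
| "fv (All x \<phi>) = fv \<phi> - {x}"

primrec qr :: "'r fm \<Rightarrow> nat" where
  "qr Tru = 0"
| "qr Fls = 0"
| "qr (Eq x y) = 0"
| "qr (Neq x y) = 0"
| "qr (Lit L) = 0"
| "qr (And \<phi> \<psi>) = max (qr \<phi>) (qr \<psi>)"
| "qr (Or \<phi> \<psi>) = max (qr \<phi>) (qr \<psi>)"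
| "qr (Ex x \<phi>) = Suc (qr \<phi>)"
| "qr (All x \<phi>) = Suc (qr \<phi>)"

text \<open>
  Sums and products over the possibly infinite universe are taken over the set of values
  attained.  This set is finite since \<open>'s\<close> is, and by full idempotence multiplicities do not
  matter.
\<close>

primrec sem ::
  "('r, 'a, 's::{lattice_semiring,finite}) interp \<Rightarrow> 'r fm \<Rightarrow> (nat \<Rightarrow> 'a) \<Rightarrow> 's" where
  "sem \<pi> Tru \<alpha> = 1"
| "sem \<pi> Fls \<alpha> = 0"
| "sem \<pi> (Eq x y) \<alpha> = (if \<alpha> x = \<alpha> y then 1 else 0)"
| "sem \<pi> (Neq x y) \<alpha> = (if \<alpha> x \<noteq> \<alpha> y then 1 else 0)"
| "sem \<pi> (Lit L) \<alpha> = \<pi> (map_lit \<alpha> L)"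
| "sem \<pi> (And \<phi> \<psi>) \<alpha> = sem \<pi> \<phi> \<alpha> * sem \<pi> \<psi> \<alpha>"
| "sem \<pi> (Or \<phi> \<psi>) \<alpha> = sem \<pi> \<phi> \<alpha> + sem \<pi> \<psi> \<alpha>"
| "sem \<pi> (Ex x \<phi>) \<alpha> = (\<Sum>v \<in> range (\<lambda>a. sem \<pi> \<phi> (\<alpha>(x := a))). v)"
| "sem \<pi> (All x \<phi>) \<alpha> = (\<Prod>v \<in> range (\<lambda>a. sem \<pi> \<phi> (\<alpha>(x := a))). v)"

text \<open>
  A tuple of length \<open>n\<close> is a list; it interprets the variables \<open>0, \<dots>, n - 1\<close>.
\<close>

definition val ::
  "('r, 'a, 's::{lattice_semiring,finite}) interp \<Rightarrow> 'r fm \<Rightarrow> 'a list \<Rightarrow> 's" where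
  "val \<pi> \<phi> c = sem \<pi> \<phi> (\<lambda>i. c ! i)"

definition equiv_upto ::
  "'r set \<Rightarrow> ('r \<Rightarrow> nat) \<Rightarrow> nat \<Rightarrow>
   ('r, 'a, 's::{lattice_semiring,finite}) interp \<Rightarrow> 'a list \<Rightarrow>
   ('r, 'b, 's) interp \<Rightarrow> 'b list \<Rightarrow> bool" where
  "equiv_upto \<tau> ar m \<pi>A a \<pi>B b \<longleftrightarrow>
     (\<forall>\<phi>. wf_fm \<tau> ar \<phi> \<and> fv \<phi> \<subseteq> {..<length a} \<and> qr \<phi> \<le> m \<longrightarrow> val \<pi>A \<phi> a = val \<pi>B \<phi> b)"

text \<open>
  Conjunction and disjunction of a finite set of formulae, in an arbitrary but fixed order.
\<close>

definition BigAnd :: "'r fm set \<Rightarrow> 'r fm" where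
  "BigAnd \<Phi> = foldr And (SOME \<phi>s. distinct \<phi>s \<and> set \<phi>s = \<Phi>) Tru"

definition BigOr :: "'r fm set \<Rightarrow> 'r fm" where
  "BigOr \<Phi> = foldr Or (SOME \<phi>s. distinct \<phi>s \<and> set \<phi>s = \<Phi>) Fls"

definition eq_fm :: "'a list \<Rightarrow> 'r fm" where
  "eq_fm c = BigAnd
     ({Eq i j | i j. i < length c \<and> j < length c \<and> c ! i = c ! j} \<union>
      {Neq i j | i j. i < length c \<and> j < length c \<and> c ! i \<noteq> c ! j})"

text \<open>
  In \<open>char_fm \<tau> ar \<pi> s (Suc m) c\<close> the quantified variable is the first one not used by \<open>c\<close>,
  namely \<open>length c\<close>, so that the extended tuple \<open>c @ [e]\<close> interprets the variables up to it.
\<close>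

primrec char_fm ::
  "'r set \<Rightarrow> ('r \<Rightarrow> nat) \<Rightarrow> ('r, 'a, 's::{lattice_semiring,finite}) interp \<Rightarrow> 's \<Rightarrow>
   nat \<Rightarrow> 'a list \<Rightarrow> 'r fm" where
  "char_fm \<tau> ar \<pi> s 0 c =
     And (eq_fm c)
       (BigAnd {Lit L | L. L \<in> lits_over \<tau> ar {..<length c} \<and>
          \<pi> (map_lit (\<lambda>i. c ! i) L) + s = \<pi> (map_lit (\<lambda>i. c ! i) L)})"
| "char_fm \<tau> ar \<pi> s (Suc m) c =
     And (BigAnd (range (\<lambda>e. Ex (length c) (char_fm \<tau> ar \<pi> s m (c @ [e])))))
       (All (length c) (BigOr (range (\<lambda>e. char_fm \<tau> ar \<pi> s m (c @ [e])))))"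

text \<open>
  A move of Spoiler is \<open>Inl x\<close> (an element of the first universe) or \<open>Inr y\<close> (one of the
  second).  A strategy of Duplicator for the rounds maps the list of Spoiler's previous moves
  to the answers in the second and in the first universe.
\<close>

type_synonym ('a, 'b) strategy = "('a + 'b) list \<Rightarrow> ('a \<Rightarrow> 'b) \<times> ('b \<Rightarrow> 'a)"

fun play :: "('a, 'b) strategy \<Rightarrow> ('a + 'b) list \<Rightarrow> ('a + 'b) list \<Rightarrow>
    'a list \<Rightarrow> 'b list \<Rightarrow> 'a list \<times> 'b list" where
  "play \<sigma> h [] a b = (a, b)"
| "play \<sigma> h (Inl x # ms) a b = play \<sigma> (h @ [Inl x]) ms (a @ [x]) (b @ [fst (\<sigma> h) x])"
| "play \<sigma> h (Inr y # ms) a b = play \<sigma> (h @ [Inr y]) ms (a @ [snd (\<sigma> h) y]) (b @ [y])"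

definition same_eq_pattern :: "'c list \<Rightarrow> 'd list \<Rightarrow> bool" where
  "same_eq_pattern c d \<longleftrightarrow>
     length c = length d \<and>
     (\<forall>i < length c. \<forall>j < length c. c ! i = c ! j \<longleftrightarrow> d ! i = d ! j)"

definition win_cond ::
  "'r set \<Rightarrow> ('r \<Rightarrow> nat) \<Rightarrow> 's::lattice_semiring \<Rightarrow>
   ('r, 'c, 's) interp \<Rightarrow> 'c list \<Rightarrow> ('r, 'd, 's) interp \<Rightarrow> 'd list \<Rightarrow> bool" where
  "win_cond \<tau> ar s \<pi>0 c \<pi>1 d \<longleftrightarrow>
     same_eq_pattern c d \<and>
     (\<forall>L \<in> lits_over \<tau> ar {..<length c}.
        \<pi>0 (map_lit (\<lambda>i. c ! i) L) + s = \<pi>0 (map_lit (\<lambda>i. c ! i) L) \<longrightarrow>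
        \<pi>1 (map_lit (\<lambda>i. d ! i) L) + s = \<pi>1 (map_lit (\<lambda>i. d ! i) L))"

text \<open>
  Spoiler's initial choice of \<open>(\<pi>\<^sub>0, c, \<pi>\<^sub>1, d)\<close>: \<open>Forward\<close> is \<open>(\<pi>A, a, \<pi>B, b)\<close> and \<open>Backward\<close>
  is \<open>(\<pi>B, b, \<pi>A, a)\<close>.  It only affects the winning condition.
\<close>

datatype direction = Forward | Backward

primrec won_by_duplicator ::
  "'r set \<Rightarrow> ('r \<Rightarrow> nat) \<Rightarrow> 's::lattice_semiring \<Rightarrow>
   ('r, 'a, 's) interp \<Rightarrow> ('r, 'b, 's) interp \<Rightarrow> direction \<Rightarrow>
   'a list \<times> 'b list \<Rightarrow> bool" where
  "won_by_duplicator \<tau> ar s \<pi>A \<pi>B Forward p \<longleftrightarrow> win_cond \<tau> ar s \<pi>A (fst p) \<pi>B (snd p)"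
| "won_by_duplicator \<tau> ar s \<pi>A \<pi>B Backward p \<longleftrightarrow> win_cond \<tau> ar s \<pi>B (snd p) \<pi>A (fst p)"

definition duplicator_wins_HG ::
  "'r set \<Rightarrow> ('r \<Rightarrow> nat) \<Rightarrow> nat \<Rightarrow>
   ('r, 'a, 's::lattice_semiring) interp \<Rightarrow> 'a list \<Rightarrow>
   ('r, 'b, 's) interp \<Rightarrow> 'b list \<Rightarrow> bool" where
  "duplicator_wins_HG \<tau> ar m \<pi>A a \<pi>B b \<longleftrightarrow>
     (\<exists>\<sigma> :: 's \<Rightarrow> direction \<Rightarrow> ('a, 'b) strategy.
        \<forall>s \<in> idc. \<forall>dir. \<forall>ms. length ms = m \<longrightarrow>
          won_by_duplicator \<tau> ar s \<pi>A \<pi>B dir (play (\<sigma> s dir) [] ms a b))"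

text \<open>
  Soundness and completeness of a game, given by the relation \<open>W\<close> of Duplicator having a
  winning strategy, for an equivalence relation \<open>E\<close>.
\<close>

definition game_sound ::
  "(('r, 'a, 's) interp \<Rightarrow> 'a list \<Rightarrow> ('r, 'b, 's) interp \<Rightarrow> 'b list \<Rightarrow> bool) \<Rightarrow>
   (('r, 'a, 's) interp \<Rightarrow> 'a list \<Rightarrow> ('r, 'b, 's) interp \<Rightarrow> 'b list \<Rightarrow> bool) \<Rightarrow> bool" where
  "game_sound W E \<longleftrightarrow>
     (\<forall>\<pi>A a \<pi>B b. length a = length b \<longrightarrow> W \<pi>A a \<pi>B b \<longrightarrow> E \<pi>A a \<pi>B b)"

definition game_complete ::
  "(('r, 'a, 's) interp \<Rightarrow> 'a list \<Rightarrow> ('r, 'b, 's) interp \<Rightarrow> 'b list \<Rightarrow> bool) \<Rightarrow>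
   (('r, 'a, 's) interp \<Rightarrow> 'a list \<Rightarrow> ('r, 'b, 's) interp \<Rightarrow> 'b list \<Rightarrow> bool) \<Rightarrow> bool" where
  "game_complete W E \<longleftrightarrow>
     (\<forall>\<pi>A a \<pi>B b. length a = length b \<longrightarrow> E \<pi>A a \<pi>B b \<longrightarrow> W \<pi>A a \<pi>B b)"

end

theory Submission
  imports Defs
begin

text \<open>
  A \<open>+\<close>-indecomposable element \<open>s\<close> of a finite lattice semiring is join-prime, so
  \<open>x \<mapsto> (s \<le> x)\<close> is a homomorphism onto the Boolean semiring, and finitely many such
  homomorphisms separate the elements.  Each of them reduces the semantics to a Boolean one, for
  which the classical Ehrenfeucht-Fraisse argument applies, except that literals are only
  preserved in one direction; this is why Spoiler also chooses the direction.
\<close>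

section \<open>Join-prime elements\<close>

text \<open>Idempotence absorbs a second copy of \<open>s\<close> when \<open>x = s + c\<close>, so
  addition is the join of the natural order. Every condition \<open>x + s = x\<close> of the game
  and of the characteristic formulae thereby becomes \<open>s \<le> x\<close>.\<close>

lemma add_eq_left_iff_le: "x + s = x \<longleftrightarrow> s \<le> x" for s x :: "'s::lattice_semiring"
proof
  assume "x + s = x"
  then show "s \<le> x" by (metis add.commute le_iff_add)
next
  assume "s \<le> x"
  then obtain c where "x = s + c" by (auto simp: le_iff_add)
  then show "x + s = x" by (metis add.assoc add.commute add_idem)
qed

text \<open>Multiplication is the meet: for \<open>x = s + c\<close> one gets
  \<open>s * x = s + s * c = s\<close> by idempotence and absorption.\<close>

lemma mult_eq_left_iff_le: "s * x = s \<longleftrightarrow> s \<le> x" for s x :: "'s::lattice_semiring"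
proof
  assume "s * x = s"
  then have "x + s = x" by (metis absorptive mult.commute)
  then show "s \<le> x" by (simp add: add_eq_left_iff_le)
next
  assume "s \<le> x"
  then obtain c where "x = s + c" by (auto simp: le_iff_add)
  then show "s * x = s" by (simp add: distrib_left mult_idem absorptive)
qed

lemma le_one: "s \<le> 1" for s :: "'s::lattice_semiring"
  by (metis mult_eq_left_iff_le mult_1_right)

lemma le_mult_iff: "s \<le> x * y \<longleftrightarrow> s \<le> x \<and> s \<le> y" for s x y :: "'s::lattice_semiring"
proof -
  have "x * y \<le> x" "x * y \<le> y"
    by (metis absorptive add_eq_left_iff_le mult.commute)+
  moreover have "s \<le> x * y" if "s \<le> x" "s \<le> y"
    using that by (metis mult_eq_left_iff_le mult.assoc)
  ultimately show ?thesis by (meson order_trans)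
qed

lemma idc_not_le_zero: "s \<in> idc \<Longrightarrow> \<not> s \<le> 0"
  by (simp add: idc_def)

text \<open>Join-primeness. If \<open>s\<close> lies below \<open>x + y\<close>, then
  \<open>s = s * (x + y) = s * x + s * y\<close>, and indecomposability forces one of these summands
  to be \<open>s\<close> itself.\<close>

lemma idc_le_add_iff:
  assumes "s \<in> idc"
  shows "s \<le> x + y \<longleftrightarrow> s \<le> x \<or> s \<le> y"
proof
  assume "s \<le> x + y"
  then have "s * x + s * y = s"
    by (metis mult_eq_left_iff_le distrib_left)
  then have "s * x = s \<or> s * y = s"
    using assms by (auto simp: idc_def)
  then show "s \<le> x \<or> s \<le> y" by (simp add: mult_eq_left_iff_le)
next
  assume "s \<le> x \<or> s \<le> y"
  then show "s \<le> x + y"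
    by (metis add.commute add_increasing2 zero_le)
qed

lemma idc_le_sum_iff:
  assumes "s \<in> idc" "finite A"
  shows "s \<le> sum f A \<longleftrightarrow> (\<exists>x\<in>A. s \<le> f x)"
  using assms(2)
  by (induction A rule: finite_induct)
     (simp_all add: idc_le_add_iff[OF assms(1)] idc_not_le_zero[OF assms(1)] del: le_zero_eq)

lemma le_prod_iff:
  fixes f :: "'i \<Rightarrow> 's::lattice_semiring"
  assumes "finite A"
  shows "s \<le> prod f A \<longleftrightarrow> (\<forall>x\<in>A. s \<le> f x)"
  using assms by (induction A rule: finite_induct) (simp_all add: le_one le_mult_iff)

text \<open>Indecomposables separate the elements, because every element is a finite sum of them.
  The induction is on the number of elements strictly below \<open>x\<close>: an indecomposable
  \<open>x\<close> is its own test element, and any other non-zero \<open>x\<close> splits into two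
  strictly smaller summands, each below \<open>y\<close> by induction.\<close>

lemma le_if_idc_le:
  fixes x y :: "'s::{lattice_semiring,finite}"
  assumes "\<And>s. s \<in> idc \<Longrightarrow> s \<le> x \<Longrightarrow> s \<le> y"
  shows "x \<le> y"
  using assms
proof (induction "card {z. z < x}" arbitrary: x rule: less_induct)
  case less
  consider "x = 0" | "x \<in> idc" | r t where "r \<noteq> x" "t \<noteq> x" "r + t = x"
    by (auto simp: idc_def)
  then show ?case
  proof cases
    case 1
    then show ?thesis by simp
  next
    case 2
    then show ?thesis using less.prems by blast
  next
    case 3
    have below: "z \<le> y" if "z \<le> x" "z \<noteq> x" for z
    proof (rule less.hyps)
      have "{w. w < z} \<subset> {w. w < x}" using that by fastforce
      then show "card {w. w < z} < card {w. w < x}" by (intro psubset_card_mono) auto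
      show "s \<le> y" if "s \<in> idc" "s \<le> z" for s
        using that less.prems \<open>z \<le> x\<close> by (meson order_trans)
    qed
    have "r \<le> x" "t \<le> x" using 3 by (metis add.commute le_iff_add)+
    then have "r + t \<le> y + y" using 3 below by (intro add_mono) auto
    then show ?thesis using 3 by (simp add: add_idem)
  qed
qed

lemma eq_if_idc_le_iff:
  fixes x y :: "'s::{lattice_semiring,finite}"
  assumes "\<And>s. s \<in> idc \<Longrightarrow> s \<le> x \<longleftrightarrow> s \<le> y"
  shows "x = y"
  by (rule antisym; rule le_if_idc_le) (simp_all add: assms)

section \<open>Semantics at a fixed indecomposable element\<close>

lemma le_sem_Eq_iff: "s \<in> idc \<Longrightarrow> s \<le> sem \<pi> (Eq x y) \<alpha> \<longleftrightarrow> \<alpha> x = \<alpha> y"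
  using idc_not_le_zero by (auto simp: le_one)

lemma le_sem_Neq_iff: "s \<in> idc \<Longrightarrow> s \<le> sem \<pi> (Neq x y) \<alpha> \<longleftrightarrow> \<alpha> x \<noteq> \<alpha> y"
  using idc_not_le_zero by (auto simp: le_one)

text \<open>Join-primeness lets the sum behave like a Boolean disjunction, so some element of the
  universe witnesses it; the set of summands is finite because \<open>'s\<close> is.\<close>

lemma le_sem_Ex_iff:
  "s \<in> idc \<Longrightarrow> s \<le> sem \<pi> (Ex x \<phi>) \<alpha> \<longleftrightarrow> (\<exists>e. s \<le> sem \<pi> \<phi> (\<alpha>(x := e)))"
  by (simp add: idc_le_sum_iff)

lemma le_sem_All_iff:
  "s \<le> sem \<pi> (All x \<phi>) \<alpha> \<longleftrightarrow> (\<forall>e. s \<le> sem \<pi> \<phi> (\<alpha>(x := e)))"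
  by (simp add: le_prod_iff)

text \<open>A finite set has a duplicate-free listing, so the choice inside \<open>BigAnd\<close>
  and \<open>BigOr\<close> succeeds. Afterwards only the set of listed formulae matters.\<close>

lemma set_some_distinct_list:
  assumes "finite A"
  shows "set (SOME xs. distinct xs \<and> set xs = A) = A"
  by (rule someI2_ex) (use assms in \<open>auto dest: finite_distinct_list\<close>)

lemma le_sem_BigAnd_iff:
  assumes "finite \<Phi>"
  shows "s \<le> sem \<pi> (BigAnd \<Phi>) \<alpha> \<longleftrightarrow> (\<forall>\<phi>\<in>\<Phi>. s \<le> sem \<pi> \<phi> \<alpha>)"
proof -
  have "s \<le> sem \<pi> (foldr And \<phi>s Tru) \<alpha> \<longleftrightarrow> (\<forall>\<phi>\<in>set \<phi>s. s \<le> sem \<pi> \<phi> \<alpha>)" for \<phi>s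
    by (induction \<phi>s) (simp_all add: le_one le_mult_iff)
  then show ?thesis by (simp add: BigAnd_def set_some_distinct_list[OF assms])
qed

lemma le_sem_BigOr_iff:
  assumes "s \<in> idc" "finite \<Phi>"
  shows "s \<le> sem \<pi> (BigOr \<Phi>) \<alpha> \<longleftrightarrow> (\<exists>\<phi>\<in>\<Phi>. s \<le> sem \<pi> \<phi> \<alpha>)"
proof -
  have "s \<le> sem \<pi> (foldr Or \<phi>s Fls) \<alpha> \<longleftrightarrow> (\<exists>\<phi>\<in>set \<phi>s. s \<le> sem \<pi> \<phi> \<alpha>)" for \<phi>s
    by (induction \<phi>s)
       (simp_all add: idc_le_add_iff[OF assms(1)] idc_not_le_zero[OF assms(1)] del: le_zero_eq)
  then show ?thesis by (simp add: BigOr_def set_some_distinct_list[OF assms(2)])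
qed

section \<open>Syntax of finite conjunctions and disjunctions\<close>

lemma fv_BigAnd: "finite \<Phi> \<Longrightarrow> fv (BigAnd \<Phi>) = (\<Union>\<phi>\<in>\<Phi>. fv \<phi>)"
proof -
  assume fin: "finite \<Phi>"
  have "fv (foldr And \<phi>s Tru) = (\<Union>\<phi>\<in>set \<phi>s. fv \<phi>)" for \<phi>s :: "'a fm list"
    by (induction \<phi>s) simp_all
  then show ?thesis by (simp add: BigAnd_def set_some_distinct_list[OF fin])
qed

lemma fv_BigOr: "finite \<Phi> \<Longrightarrow> fv (BigOr \<Phi>) = (\<Union>\<phi>\<in>\<Phi>. fv \<phi>)"
proof -
  assume fin: "finite \<Phi>"
  have "fv (foldr Or \<phi>s Fls) = (\<Union>\<phi>\<in>set \<phi>s. fv \<phi>)" for \<phi>s :: "'a fm list"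
    by (induction \<phi>s) simp_all
  then show ?thesis by (simp add: BigOr_def set_some_distinct_list[OF fin])
qed

lemma wf_fm_BigAnd: "finite \<Phi> \<Longrightarrow> wf_fm \<tau> ar (BigAnd \<Phi>) \<longleftrightarrow> (\<forall>\<phi>\<in>\<Phi>. wf_fm \<tau> ar \<phi>)"
proof -
  assume fin: "finite \<Phi>"
  have "wf_fm \<tau> ar (foldr And \<phi>s Tru) \<longleftrightarrow> (\<forall>\<phi>\<in>set \<phi>s. wf_fm \<tau> ar \<phi>)" for \<phi>s
    by (induction \<phi>s) simp_all
  then show ?thesis by (simp add: BigAnd_def set_some_distinct_list[OF fin])
qed

lemma wf_fm_BigOr: "finite \<Phi> \<Longrightarrow> wf_fm \<tau> ar (BigOr \<Phi>) \<longleftrightarrow> (\<forall>\<phi>\<in>\<Phi>. wf_fm \<tau> ar \<phi>)"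
proof -
  assume fin: "finite \<Phi>"
  have "wf_fm \<tau> ar (foldr Or \<phi>s Fls) \<longleftrightarrow> (\<forall>\<phi>\<in>set \<phi>s. wf_fm \<tau> ar \<phi>)" for \<phi>s
    by (induction \<phi>s) simp_all
  then show ?thesis by (simp add: BigOr_def set_some_distinct_list[OF fin])
qed

lemma qr_BigAnd_le_iff: "finite \<Phi> \<Longrightarrow> qr (BigAnd \<Phi>) \<le> m \<longleftrightarrow> (\<forall>\<phi>\<in>\<Phi>. qr \<phi> \<le> m)"
proof -
  assume fin: "finite \<Phi>"
  have "qr (foldr And \<phi>s Tru) \<le> m \<longleftrightarrow> (\<forall>\<phi>\<in>set \<phi>s. qr \<phi> \<le> m)" for \<phi>s :: "'a fm list"
    by (induction \<phi>s) simp_all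
  then show ?thesis by (simp add: BigAnd_def set_some_distinct_list[OF fin])
qed

lemma qr_BigOr_le_iff: "finite \<Phi> \<Longrightarrow> qr (BigOr \<Phi>) \<le> m \<longleftrightarrow> (\<forall>\<phi>\<in>\<Phi>. qr \<phi> \<le> m)"
proof -
  assume fin: "finite \<Phi>"
  have "qr (foldr Or \<phi>s Fls) \<le> m \<longleftrightarrow> (\<forall>\<phi>\<in>set \<phi>s. qr \<phi> \<le> m)" for \<phi>s :: "'a fm list"
    by (induction \<phi>s) simp_all
  then show ?thesis by (simp add: BigOr_def set_some_distinct_list[OF fin])
qed

text \<open>Coincidence lemma. It is needed because the assignment \<open>(!) c\<close> is
  unspecified beyond the end of the tuple, so assignments can only be compared on free
  variables.\<close>

lemma sem_cong_fv:
  assumes "\<And>x. x \<in> fv \<phi> \<Longrightarrow> \<alpha> x = \<beta> x"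
  shows "sem \<pi> \<phi> \<alpha> = sem \<pi> \<phi> \<beta>"
  using assms
proof (induction \<phi> arbitrary: \<alpha> \<beta>)
  case (Eq x y)
  show ?case using Eq.prems[of x] Eq.prems[of y] by simp
next
  case (Neq x y)
  show ?case using Neq.prems[of x] Neq.prems[of y] by simp
next
  case (Lit L)
  then have "map_lit \<alpha> L = map_lit \<beta> L" by (intro lit.map_cong) auto
  then show ?case by simp
next
  case (And \<phi> \<psi>)
  have "sem \<pi> \<phi> \<alpha> = sem \<pi> \<phi> \<beta>" by (rule And.IH(1)) (use And.prems in auto)
  moreover have "sem \<pi> \<psi> \<alpha> = sem \<pi> \<psi> \<beta>" by (rule And.IH(2)) (use And.prems in auto)
  ultimately show ?case by simp
next
  case (Or \<phi> \<psi>)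
  have "sem \<pi> \<phi> \<alpha> = sem \<pi> \<phi> \<beta>" by (rule Or.IH(1)) (use Or.prems in auto)
  moreover have "sem \<pi> \<psi> \<alpha> = sem \<pi> \<psi> \<beta>" by (rule Or.IH(2)) (use Or.prems in auto)
  ultimately show ?case by simp
next
  case (Ex x \<phi>)
  have "sem \<pi> \<phi> (\<alpha>(x := e)) = sem \<pi> \<phi> (\<beta>(x := e))" for e
    by (rule Ex.IH) (use Ex.prems in auto)
  then show ?case by simp
next
  case (All x \<phi>)
  have "sem \<pi> \<phi> (\<alpha>(x := e)) = sem \<pi> \<phi> (\<beta>(x := e))" for e
    by (rule All.IH) (use All.prems in auto)
  then show ?case by simp
qed simp_all

section \<open>Characteristic formulae\<close>

lemma finite_lits_over:
  assumes "finite \<tau>" "finite V"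
  shows "finite (lits_over \<tau> ar V)"
proof -
  let ?X = "\<Union>R\<in>\<tau>. {xs. set xs \<subseteq> V \<and> length xs = ar R}"
  have "finite ?X" using assms finite_lists_length_eq by auto
  moreover have "lits_over \<tau> ar V \<subseteq>
      (\<lambda>(R, xs). PosL R xs) ` (\<tau> \<times> ?X) \<union> (\<lambda>(R, xs). NegL R xs) ` (\<tau> \<times> ?X)"
    by (fastforce simp: lits_over_def)
  ultimately show ?thesis using assms(1)
    by (meson finite_SigmaI finite_UnI finite_imageI finite_subset)
qed

lemma set_lit_lits_over: "L \<in> lits_over \<tau> ar V \<Longrightarrow> set_lit L \<subseteq> V"
  by (auto simp: lits_over_def)

lemma lits_over_mono: "V \<subseteq> W \<Longrightarrow> lits_over \<tau> ar V \<subseteq> lits_over \<tau> ar W"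
  by (auto simp: lits_over_def)

lemma map_lit_lits_over:
  "L \<in> lits_over \<tau> ar V \<Longrightarrow> f ` set_lit L \<subseteq> W \<Longrightarrow> map_lit f L \<in> lits_over \<tau> ar W"
  by (auto simp: lits_over_def)

text \<open>Together with \<open>lit_fms\<close>, this names the sets of conjuncts of
  \<open>char_fm\<close> at rank 0, so that their finiteness can be stated.\<close>

definition eq_fms :: "'a list \<Rightarrow> 'r fm set" where
  "eq_fms c = {Eq i j | i j. i < length c \<and> j < length c \<and> c ! i = c ! j} \<union>
      {Neq i j | i j. i < length c \<and> j < length c \<and> c ! i \<noteq> c ! j}"

definition lit_fms ::
  "'r set \<Rightarrow> ('r \<Rightarrow> nat) \<Rightarrow> ('r, 'a, 's::lattice_semiring) interp \<Rightarrow> 's \<Rightarrow> 'a list \<Rightarrow> 'r fm set"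
  where
  "lit_fms \<tau> ar \<pi> s c = {Lit L | L. L \<in> lits_over \<tau> ar {..<length c} \<and>
     \<pi> (map_lit (\<lambda>i. c ! i) L) + s = \<pi> (map_lit (\<lambda>i. c ! i) L)}"

lemma char_fm_0: "char_fm \<tau> ar \<pi> s 0 c = And (BigAnd (eq_fms c)) (BigAnd (lit_fms \<tau> ar \<pi> s c))"
  by (simp add: eq_fm_def eq_fms_def lit_fms_def)

lemma eq_fms_subset:
  "eq_fms c \<subseteq> (\<lambda>(i, j). Eq i j) ` ({..<length c} \<times> {..<length c}) \<union>
     (\<lambda>(i, j). Neq i j) ` ({..<length c} \<times> {..<length c})"
  by (auto simp: eq_fms_def)

lemma lit_fms_subset: "lit_fms \<tau> ar \<pi> s c \<subseteq> Lit ` lits_over \<tau> ar {..<length c}"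
  by (auto simp: lit_fms_def)

lemma finite_eq_fms: "finite (eq_fms c)"
  by (rule finite_subset[OF eq_fms_subset]) auto

lemma finite_lit_fms: "finite \<tau> \<Longrightarrow> finite (lit_fms \<tau> ar \<pi> s c)"
  by (rule finite_subset[OF lit_fms_subset]) (simp add: finite_lits_over)

text \<open>The universe may be infinite, so \<open>BigAnd\<close> and \<open>BigOr\<close> over a
  range of characteristic formulae make sense only by this bound. At rank 0 a formula is determined
  by a subset of the finitely many atoms in \<open>n\<close> variables; at rank \<open>Suc m\<close>
  it is determined by the set of rank-\<open>m\<close> formulae of the extended tuples.\<close>

lemma finite_char_fms:
  assumes "finite \<tau>"
  shows "finite {char_fm \<tau> ar \<pi> s m c | c. length c = n}"
proof (induction m arbitrary: n)
  case 0
  let ?E = "(\<lambda>(i, j). Eq i j) ` ({..<n} \<times> {..<n}) \<union> (\<lambda>(i, j). Neq i j) ` ({..<n} \<times> {..<n})"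
  let ?L = "Lit ` lits_over \<tau> ar {..<n}"
  let ?F = "(\<lambda>(E, L). And (BigAnd E) (BigAnd L)) ` (Pow ?E \<times> Pow ?L)"
  have "char_fm \<tau> ar \<pi> s 0 c \<in> ?F" if "length c = n" for c
  proof -
    have "(eq_fms c, lit_fms \<tau> ar \<pi> s c) \<in> Pow ?E \<times> Pow ?L"
      using eq_fms_subset[of c] lit_fms_subset[of \<tau> ar \<pi> s c] that by blast
    then show ?thesis unfolding char_fm_0 by force
  qed
  then have "{char_fm \<tau> ar \<pi> s 0 c | c. length c = n} \<subseteq> ?F" by blast
  moreover have "finite ?F" using assms by (simp add: finite_lits_over)
  ultimately show ?case by (rule finite_subset)
next
  case (Suc m)
  let ?C = "{char_fm \<tau> ar \<pi> s m c | c. length c = Suc n}"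
  \<comment> \<open>The choice of a listing depends on the set alone, so equal sets \<open>X\<close>
    give identical formulae and there are at most as many formulae as subsets of
    \<open>?C\<close>.\<close>
  let ?F = "(\<lambda>X. And (BigAnd (Ex n ` X)) (All n (BigOr X))) ` Pow ?C"
  have "char_fm \<tau> ar \<pi> s (Suc m) c \<in> ?F" if "length c = n" for c
  proof (rule image_eqI)
    show "range (\<lambda>e. char_fm \<tau> ar \<pi> s m (c @ [e])) \<in> Pow ?C"
      using that by force
  qed (simp add: that image_image)
  then have "{char_fm \<tau> ar \<pi> s (Suc m) c | c. length c = n} \<subseteq> ?F" by blast
  moreover have "finite ?F" using Suc.IH by simp
  ultimately show ?case by (rule finite_subset)
qed

lemma finite_range_char_fm:
  assumes "finite \<tau>"
  shows "finite (range (\<lambda>e. char_fm \<tau> ar \<pi> s m (c @ [e])))"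
  by (rule finite_subset[OF _ finite_char_fms[OF assms, of ar \<pi> s m "Suc (length c)"]]) force

lemma finite_range_Ex_char_fm:
  assumes "finite \<tau>"
  shows "finite (range (\<lambda>e. Ex x (char_fm \<tau> ar \<pi> s m (c @ [e]))))"
  using finite_imageI[OF finite_range_char_fm[OF assms, of ar \<pi> s m c], of "Ex x"]
  by (simp add: image_image)

section \<open>Variables, vocabulary and rank of characteristic formulae\<close>

lemma fv_char_fm:
  assumes "finite \<tau>"
  shows "fv (char_fm \<tau> ar \<pi> s m c) \<subseteq> {..<length c}"
proof (induction m arbitrary: c)
  case 0
  show ?case
    unfolding char_fm_0 fv.simps fv_BigAnd[OF finite_eq_fms] fv_BigAnd[OF finite_lit_fms[OF assms]]
    using set_lit_lits_over by (fastforce simp: eq_fms_def lit_fms_def)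
next
  case (Suc m)
  have "fv (char_fm \<tau> ar \<pi> s m (c @ [e])) - {length c} \<subseteq> {..<length c}" for e
    using Suc.IH[of "c @ [e]"] by force
  then show ?case
    by (auto simp: fv_BigAnd fv_BigOr finite_range_char_fm[OF assms]
        finite_range_Ex_char_fm[OF assms])
qed

lemma wf_fm_char_fm:
  assumes "finite \<tau>"
  shows "wf_fm \<tau> ar (char_fm \<tau> ar \<pi> s m c)"
proof (induction m arbitrary: c)
  case 0
  show ?case
    unfolding char_fm_0 wf_fm.simps wf_fm_BigAnd[OF finite_eq_fms]
      wf_fm_BigAnd[OF finite_lit_fms[OF assms]]
    using lits_over_mono[OF subset_UNIV] by (fastforce simp: eq_fms_def lit_fms_def)
next
  case (Suc m)
  then show ?case
    by (simp add: wf_fm_BigAnd wf_fm_BigOr finite_range_char_fm[OF assms]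
        finite_range_Ex_char_fm[OF assms])
qed

text \<open>With \<open>fv_char_fm\<close> and \<open>wf_fm_char_fm\<close>, this places
  characteristic formulae among those compared by \<open>equiv_upto\<close>.\<close>

lemma qr_char_fm_le:
  assumes "finite \<tau>"
  shows "qr (char_fm \<tau> ar \<pi> s m c) \<le> m"
proof (induction m arbitrary: c)
  case 0
  have "qr (BigAnd (eq_fms c)) \<le> 0" "qr (BigAnd (lit_fms \<tau> ar \<pi> s c)) \<le> 0"
    unfolding qr_BigAnd_le_iff[OF finite_eq_fms] qr_BigAnd_le_iff[OF finite_lit_fms[OF assms]]
    by (auto simp: eq_fms_def lit_fms_def)
  then show ?case unfolding char_fm_0 by simp
next
  case (Suc m)
  then show ?case
    by (simp add: qr_BigAnd_le_iff qr_BigOr_le_iff finite_range_char_fm[OF assms]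
        finite_range_Ex_char_fm[OF assms])
qed

section \<open>Back-and-forth relations\<close>

text \<open>The strategy-free form of the Ehrenfeucht-Fraisse game. The final condition
  \<open>W\<close> is a parameter, so that one notion serves both initial directions and every
  \<open>s\<close>.\<close>

primrec back_forth ::
  "('a list \<Rightarrow> 'b list \<Rightarrow> bool) \<Rightarrow> nat \<Rightarrow> 'a list \<Rightarrow> 'b list \<Rightarrow> bool" where
  "back_forth W 0 a b \<longleftrightarrow> W a b"
| "back_forth W (Suc m) a b \<longleftrightarrow>
     (\<forall>x. \<exists>y. back_forth W m (a @ [x]) (b @ [y])) \<and>
     (\<forall>y. \<exists>x. back_forth W m (a @ [x]) (b @ [y]))"

lemma back_forth_swap: "back_forth (\<lambda>b a. W a b) m b a \<longleftrightarrow> back_forth W m a b"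
proof (induction m arbitrary: a b)
  case (Suc m)
  show ?case unfolding back_forth.simps Suc.IH by blast
qed simp

text \<open>Duplicator copies every move of Spoiler.\<close>

lemma back_forth_refl: "(\<And>c. W c c) \<Longrightarrow> back_forth W m c c"
proof (induction m arbitrary: c)
  case (Suc m)
  have "back_forth W m (c @ [x]) (c @ [x])" for x
    using Suc by blast
  then show ?case unfolding back_forth.simps by blast
qed simp

section \<open>Strategies and back-and-forth relations\<close>

text \<open>After a first move \<open>z\<close>, the rest of the play is a play of its own,
  following the residual strategy that prefixes \<open>z\<close> to each history.\<close>

lemma play_Cons: "play \<sigma> (z # h) ms a b = play (\<lambda>k. \<sigma> (z # k)) h ms a b"
proof (induction ms arbitrary: h a b)
  case (Cons y ms)
  then show ?case by (cases y) simp_all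
qed simp

text \<open>Both sides unfold along Spoiler's first move: a winning strategy splits into a first
  answer and a residual strategy per move, and conversely such pieces are glued together.\<close>

lemma winning_strategy_iff_back_forth:
  "(\<exists>\<sigma>. \<forall>ms. length ms = m \<longrightarrow> W (fst (play \<sigma> [] ms a b)) (snd (play \<sigma> [] ms a b)))
     \<longleftrightarrow> back_forth W m a b"
proof (induction m arbitrary: a b)
  case 0
  show ?case by simp
next
  case (Suc m)
  let ?win = "\<lambda>m \<sigma> a b. \<forall>ms. length ms = m \<longrightarrow>
    W (fst (play \<sigma> [] ms a b)) (snd (play \<sigma> [] ms a b))"
  have step: "?win (Suc m) \<sigma> a b \<longleftrightarrow>
      (\<forall>x. ?win m (\<lambda>k. \<sigma> (Inl x # k)) (a @ [x]) (b @ [fst (\<sigma> []) x])) \<and>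
      (\<forall>y. ?win m (\<lambda>k. \<sigma> (Inr y # k)) (a @ [snd (\<sigma> []) y]) (b @ [y]))"
    (is "?l \<longleftrightarrow> ?r") for \<sigma>
  proof
    assume l: ?l
    have "?win m (\<lambda>k. \<sigma> (Inl x # k)) (a @ [x]) (b @ [fst (\<sigma> []) x])" for x
      using l[rule_format, of "Inl x # _"] by (simp add: play_Cons)
    moreover have "?win m (\<lambda>k. \<sigma> (Inr y # k)) (a @ [snd (\<sigma> []) y]) (b @ [y])" for y
      using l[rule_format, of "Inr y # _"] by (simp add: play_Cons)
    ultimately show ?r by blast
  next
    assume r: ?r
    show ?l
    proof (intro allI impI)
      fix ms :: "('a + 'b) list"
      assume "length ms = Suc m"
      then obtain z ms' where "ms = z # ms'" "length ms' = m" by (auto simp: length_Suc_conv)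
      with r show "W (fst (play \<sigma> [] ms a b)) (snd (play \<sigma> [] ms a b))"
        by (cases z) (simp_all add: play_Cons)
    qed
  qed
  show ?case
  proof
    assume "\<exists>\<sigma>. ?win (Suc m) \<sigma> a b"
    then show "back_forth W (Suc m) a b"
      unfolding step back_forth.simps Suc.IH[symmetric] by blast
  next
    assume "back_forth W (Suc m) a b"
    then have "\<forall>x. \<exists>y \<sigma>. ?win m \<sigma> (a @ [x]) (b @ [y])"
      and "\<forall>y. \<exists>x \<sigma>. ?win m \<sigma> (a @ [x]) (b @ [y])"
      unfolding back_forth.simps Suc.IH[symmetric] by blast+
    \<comment> \<open>Choice yields answers \<open>f\<close>, \<open>g\<close> to the first move
      and, for each such move, a strategy for the remaining rounds.\<close>
    then obtain f \<rho> g \<rho>' where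
      f: "\<And>x. ?win m (\<rho> x) (a @ [x]) (b @ [f x])" and
      g: "\<And>y. ?win m (\<rho>' y) (a @ [g y]) (b @ [y])"
      by metis
    \<comment> \<open>The empty history calls for the first answer; on a longer history the first
      move selects the residual strategy, which sees only the tail.\<close>
    define \<sigma> where "\<sigma> h = (case h of [] \<Rightarrow> (f, g)
      | z # k \<Rightarrow> (case z of Inl x \<Rightarrow> \<rho> x k | Inr y \<Rightarrow> \<rho>' y k))" for h
    have "?win (Suc m) \<sigma> a b"
      unfolding step by (simp add: \<sigma>_def f g)
    then show "\<exists>\<sigma>. ?win (Suc m) \<sigma> a b" by blast
  qed
qed

section \<open>The game as a pair of back-and-forth conditions\<close>

lemma win_cond_alt:
  "win_cond \<tau> ar s \<pi>0 c \<pi>1 d \<longleftrightarrow> same_eq_pattern c d \<and>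
     (\<forall>L \<in> lits_over \<tau> ar {..<length c}.
        s \<le> \<pi>0 (map_lit (\<lambda>i. c ! i) L) \<longrightarrow> s \<le> \<pi>1 (map_lit (\<lambda>i. d ! i) L))"
  by (simp add: win_cond_def add_eq_left_iff_le)

abbreviation bf ::
  "'r set \<Rightarrow> ('r \<Rightarrow> nat) \<Rightarrow> 's::lattice_semiring \<Rightarrow> ('r, 'c, 's) interp \<Rightarrow> ('r, 'd, 's) interp \<Rightarrow>
   nat \<Rightarrow> 'c list \<Rightarrow> 'd list \<Rightarrow> bool" where
  "bf \<tau> ar s \<pi>0 \<pi>1 \<equiv> back_forth (\<lambda>c d. win_cond \<tau> ar s \<pi>0 c \<pi>1 d)"

text \<open>Spoiler fixes \<open>s\<close> and the direction before the rounds, and Duplicator's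
  strategy may depend on both, so by choice the strategy can be sought separately for each
  pair.\<close>

lemma duplicator_wins_iff_bf:
  fixes \<pi>A :: "('r, 'a, 's::lattice_semiring) interp" and \<pi>B :: "('r, 'b, 's) interp"
  shows
  "duplicator_wins_HG \<tau> ar m \<pi>A a \<pi>B b \<longleftrightarrow>
     (\<forall>s\<in>idc. bf \<tau> ar s \<pi>A \<pi>B m a b \<and> bf \<tau> ar s \<pi>B \<pi>A m b a)"
proof -
  let ?P = "\<lambda>s dir \<sigma>. \<forall>ms. length ms = m \<longrightarrow>
    won_by_duplicator \<tau> ar s \<pi>A \<pi>B dir (play \<sigma> [] ms a b)"
  have "duplicator_wins_HG \<tau> ar m \<pi>A a \<pi>B b \<longleftrightarrow> (\<forall>s\<in>idc. \<forall>dir. \<exists>\<sigma>. ?P s dir \<sigma>)"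
  proof
    assume "\<forall>s\<in>idc. \<forall>dir. \<exists>\<sigma>. ?P s dir \<sigma>"
    then have "?P s dir (SOME \<sigma>. ?P s dir \<sigma>)" if "s \<in> idc" for s dir
      using someI_ex[of "?P s dir"] that by blast
    then show "duplicator_wins_HG \<tau> ar m \<pi>A a \<pi>B b"
      unfolding duplicator_wins_HG_def
      by (intro exI[of _ "\<lambda>s dir. SOME \<sigma>. ?P s dir \<sigma>"] ballI allI) blast
  qed (auto simp: duplicator_wins_HG_def)
  also have "\<dots> \<longleftrightarrow> (\<forall>s\<in>idc. (\<exists>\<sigma>. ?P s Forward \<sigma>) \<and> (\<exists>\<sigma>. ?P s Backward \<sigma>))"
  proof -
    have "(\<forall>dir. Q dir) \<longleftrightarrow> Q Forward \<and> Q Backward" for Q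
      by (metis direction.exhaust)
    then show ?thesis by (intro ball_cong refl)
  qed
  also have "\<dots> \<longleftrightarrow> (\<forall>s\<in>idc. bf \<tau> ar s \<pi>A \<pi>B m a b \<and> bf \<tau> ar s \<pi>B \<pi>A m b a)"
  proof (intro ball_cong refl arg_cong2[where f = "(\<and>)"])
    fix s :: 's
    show "(\<exists>\<sigma>. ?P s Forward \<sigma>) \<longleftrightarrow> bf \<tau> ar s \<pi>A \<pi>B m a b"
      unfolding won_by_duplicator.simps by (rule winning_strategy_iff_back_forth)
    \<comment> \<open>Plays keep the order of the two universes in either direction, so only the
      winning condition is reversed here and the relation has to be swapped afterwards.\<close>
    have "(\<exists>\<sigma>. ?P s Backward \<sigma>) \<longleftrightarrow> back_forth (\<lambda>c d. win_cond \<tau> ar s \<pi>B d \<pi>A c) m a b"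
      unfolding won_by_duplicator.simps by (rule winning_strategy_iff_back_forth)
    also have "\<dots> \<longleftrightarrow> bf \<tau> ar s \<pi>B \<pi>A m b a"
      by (rule back_forth_swap)
    finally show "(\<exists>\<sigma>. ?P s Backward \<sigma>) \<longleftrightarrow> bf \<tau> ar s \<pi>B \<pi>A m b a" .
  qed
  finally show ?thesis .
qed

section \<open>Characteristic formulae define back-and-forth relations\<close>

text \<open>The existential conjuncts express the forth condition and the universally quantified
  disjunction the back condition; join-primeness of \<open>s\<close> lets sums be read as
  disjunctions.\<close>

lemma le_val_char_fm_iff_bf:
  assumes "finite \<tau>" "s \<in> idc" "length c = length d"
  shows "s \<le> val \<pi>1 (char_fm \<tau> ar \<pi>0 s m c) d \<longleftrightarrow> bf \<tau> ar s \<pi>0 \<pi>1 m c d"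
  using assms(3)
proof (induction m arbitrary: c d)
  case 0
  have "s \<le> val \<pi>1 (BigAnd (eq_fms c)) d \<longleftrightarrow> same_eq_pattern c d"
    unfolding val_def le_sem_BigAnd_iff[OF finite_eq_fms]
  proof
    assume l: "\<forall>\<phi>\<in>eq_fms c. s \<le> sem \<pi>1 \<phi> ((!) d)"
    \<comment> \<open>Each pair of positions contributes either an equality or an inequality, which
      gives both directions of the equivalence.\<close>
    have "c ! i = c ! j \<longleftrightarrow> d ! i = d ! j" if "i < length c" "j < length c" for i j
    proof (cases "c ! i = c ! j")
      case True
      then have "Eq i j \<in> eq_fms c" using that by (auto simp: eq_fms_def)
      with l True show ?thesis using le_sem_Eq_iff[OF assms(2)] by metis
    next
      case False
      then have "Neq i j \<in> eq_fms c" using that by (auto simp: eq_fms_def)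
      with l False show ?thesis using le_sem_Neq_iff[OF assms(2)] by metis
    qed
    then show "same_eq_pattern c d" using 0 by (simp add: same_eq_pattern_def)
  next
    assume "same_eq_pattern c d"
    then show "\<forall>\<phi>\<in>eq_fms c. s \<le> sem \<pi>1 \<phi> ((!) d)"
      by (auto simp: same_eq_pattern_def eq_fms_def le_one)
  qed
  moreover have "s \<le> val \<pi>1 (BigAnd (lit_fms \<tau> ar \<pi>0 s c)) d \<longleftrightarrow>
      (\<forall>L \<in> lits_over \<tau> ar {..<length c}.
        s \<le> \<pi>0 (map_lit (\<lambda>i. c ! i) L) \<longrightarrow> s \<le> \<pi>1 (map_lit (\<lambda>i. d ! i) L))"
    unfolding val_def le_sem_BigAnd_iff[OF finite_lit_fms[OF assms(1)]]
    by (auto simp: lit_fms_def add_eq_left_iff_le)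
  ultimately show ?case
    unfolding char_fm_0 back_forth.simps win_cond_alt
    by (simp add: val_def le_mult_iff)
next
  case (Suc m)
  \<comment> \<open>As \<open>length c = length d\<close>, the quantified variable is exactly the
    position of \<open>y\<close> in \<open>d @ [y]\<close>; the two assignments agree on all indices
    up to it, which covers the free variables.\<close>
  have upd: "s \<le> sem \<pi>1 (char_fm \<tau> ar \<pi>0 s m (c @ [x])) (((!) d)(length c := y)) \<longleftrightarrow>
      bf \<tau> ar s \<pi>0 \<pi>1 m (c @ [x]) (d @ [y])" for x y
  proof -
    have "sem \<pi>1 (char_fm \<tau> ar \<pi>0 s m (c @ [x])) (((!) d)(length c := y)) =
        sem \<pi>1 (char_fm \<tau> ar \<pi>0 s m (c @ [x])) ((!) (d @ [y]))"
    proof (rule sem_cong_fv)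
      fix i assume "i \<in> fv (char_fm \<tau> ar \<pi>0 s m (c @ [x]))"
      then have "i < Suc (length c)" using fv_char_fm[OF assms(1), of ar \<pi>0 s m "c @ [x]"] by auto
      then show "(((!) d)(length c := y)) i = (d @ [y]) ! i"
        using Suc.prems by (auto simp: nth_append)
    qed
    then show ?thesis using Suc.IH[of "c @ [x]" "d @ [y]"] Suc.prems by (simp add: val_def)
  qed
  have "s \<le> val \<pi>1 (BigAnd (range (\<lambda>e. Ex (length c) (char_fm \<tau> ar \<pi>0 s m (c @ [e]))))) d \<longleftrightarrow>
      (\<forall>x. \<exists>y. bf \<tau> ar s \<pi>0 \<pi>1 m (c @ [x]) (d @ [y]))"
    unfolding val_def le_sem_BigAnd_iff[OF finite_range_Ex_char_fm[OF assms(1)]] ball_simps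
      le_sem_Ex_iff[OF assms(2)] upd by blast
  moreover have "s \<le> val \<pi>1 (All (length c)
        (BigOr (range (\<lambda>e. char_fm \<tau> ar \<pi>0 s m (c @ [e]))))) d \<longleftrightarrow>
      (\<forall>y. \<exists>x. bf \<tau> ar s \<pi>0 \<pi>1 m (c @ [x]) (d @ [y]))"
    unfolding val_def le_sem_All_iff
      le_sem_BigOr_iff[OF assms(2) finite_range_char_fm[OF assms(1)]] bex_simps upd by blast
  ultimately show ?case
    unfolding char_fm.simps back_forth.simps val_def sem.simps(6) le_mult_iff by blast
qed

section \<open>Preservation of formulae\<close>

lemma win_cond_butlast:
  assumes "win_cond \<tau> ar s \<pi>0 (c @ [x]) \<pi>1 (d @ [y])"
  shows "win_cond \<tau> ar s \<pi>0 c \<pi>1 d"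
proof -
  have len: "length c = length d"
    using assms by (simp add: win_cond_alt same_eq_pattern_def)
  have eq: "(c @ [x]) ! i = (c @ [x]) ! j \<longleftrightarrow> (d @ [y]) ! i = (d @ [y]) ! j"
    if "i < length c" "j < length c" for i j
    using assms that by (simp add: win_cond_alt same_eq_pattern_def)
  have pat: "same_eq_pattern c d"
    unfolding same_eq_pattern_def
  proof (intro conjI allI impI)
    fix i j assume "i < length c" "j < length c"
    then show "c ! i = c ! j \<longleftrightarrow> d ! i = d ! j" using eq[of i j] len by (simp add: nth_append)
  qed (rule len)
  have "s \<le> \<pi>1 (map_lit ((!) d) L)"
    if L: "L \<in> lits_over \<tau> ar {..<length c}" and le: "s \<le> \<pi>0 (map_lit ((!) c) L)" for L
  proof -
    have "L \<in> lits_over \<tau> ar {..<length (c @ [x])}"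
      using L lits_over_mono[of "{..<length c}" "{..<length (c @ [x])}"] by auto
    moreover have "map_lit ((!) (c @ [x])) L = map_lit ((!) c) L"
      "map_lit ((!) (d @ [y])) L = map_lit ((!) d) L"
      using set_lit_lits_over[OF L] len by (auto intro!: lit.map_cong simp: nth_append)
    ultimately show ?thesis using assms le unfolding win_cond_alt by metis
  qed
  with pat show ?thesis by (simp add: win_cond_alt)
qed

lemma bf_Suc_imp_bf: "bf \<tau> ar s \<pi>0 \<pi>1 (Suc m) c d \<Longrightarrow> bf \<tau> ar s \<pi>0 \<pi>1 m c d"
proof (induction m arbitrary: c d)
  case 0
  \<comment> \<open>A universe is a type and hence inhabited, so at least one pair of moves exists;
    it is then discarded.\<close>
  then obtain x y where "win_cond \<tau> ar s \<pi>0 (c @ [x]) \<pi>1 (d @ [y])"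
    unfolding back_forth.simps by blast
  then show ?case unfolding back_forth.simps by (rule win_cond_butlast)
next
  case (Suc m)
  have "\<exists>y. bf \<tau> ar s \<pi>0 \<pi>1 m (c @ [x]) (d @ [y])" for x
    \<comment> \<open>Only the outermost round is unfolded, so that the induction hypothesis applies
      to the \<open>Suc m\<close> rounds left.\<close>
    using Suc.IH Suc.prems unfolding back_forth.simps(2)[of _ "Suc m"] by blast
  moreover have "\<exists>x. bf \<tau> ar s \<pi>0 \<pi>1 m (c @ [x]) (d @ [y])" for y
    using Suc.IH Suc.prems unfolding back_forth.simps(2)[of _ "Suc m"] by blast
  ultimately show ?case by simp
qed

text \<open>Makes the winning condition available for atomic formulae while rounds are still
  left.\<close>

lemma bf_imp_win_cond: "bf \<tau> ar s \<pi>0 \<pi>1 m c d \<Longrightarrow> win_cond \<tau> ar s \<pi>0 c \<pi>1 d"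
proof (induction m)
  case (Suc m)
  then show ?case using bf_Suc_imp_bf by blast
qed simp

text \<open>
  Assignments that read off the tuples through a common index function, rather than the tuples
  themselves, make room for quantifiers rebinding a variable below \<open>length c\<close>.
\<close>

lemma bf_preserves_le_sem:
  assumes "s \<in> idc" "bf \<tau> ar s \<pi>0 \<pi>1 m c d" "wf_fm \<tau> ar \<phi>" "qr \<phi> \<le> m"
    and "\<And>x. x \<in> fv \<phi> \<Longrightarrow> f x < length c \<and> \<alpha> x = c ! f x \<and> \<beta> x = d ! f x"
    and "s \<le> sem \<pi>0 \<phi> \<alpha>"
  shows "s \<le> sem \<pi>1 \<phi> \<beta>"
  using assms(2-)
proof (induction \<phi> arbitrary: m c d f \<alpha> \<beta>)
  case Tru
  show ?case by (simp add: le_one)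
next
  case Fls
  then show ?case using idc_not_le_zero[OF assms(1)] by simp
next
  case (Eq x y)
  have "same_eq_pattern c d" using bf_imp_win_cond[OF Eq(1)] by (simp add: win_cond_alt)
  with Eq show ?case
    unfolding le_sem_Eq_iff[OF assms(1)] by (simp add: same_eq_pattern_def)
next
  case (Neq x y)
  have "same_eq_pattern c d" using bf_imp_win_cond[OF Neq(1)] by (simp add: win_cond_alt)
  with Neq show ?case
    unfolding le_sem_Neq_iff[OF assms(1)] by (simp add: same_eq_pattern_def)
next
  case (Lit L)
  \<comment> \<open>Renaming variables by \<open>f\<close> yields a literal over tuple positions,
    the kind that the winning condition speaks about.\<close>
  have "map_lit f L \<in> lits_over \<tau> ar {..<length c}"
    using Lit by (intro map_lit_lits_over[of L _ _ UNIV]) auto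
  moreover have "map_lit \<alpha> L = map_lit ((!) c) (map_lit f L)"
    "map_lit \<beta> L = map_lit ((!) d) (map_lit f L)"
    using Lit by (auto simp: lit.map_comp intro!: lit.map_cong)
  ultimately show ?case
    using bf_imp_win_cond[OF Lit(1)] Lit.prems(5) by (simp add: win_cond_alt)
next
  case (And \<phi> \<psi>)
  have "s \<le> sem \<pi>1 \<phi> \<beta>"
    by (rule And.IH(1)[of m c d f \<alpha> \<beta>]) (use And.prems in \<open>auto simp: le_mult_iff\<close>)
  moreover have "s \<le> sem \<pi>1 \<psi> \<beta>"
    by (rule And.IH(2)[of m c d f \<alpha> \<beta>]) (use And.prems in \<open>auto simp: le_mult_iff\<close>)
  ultimately show ?case by (simp add: le_mult_iff)
next
  case (Or \<phi> \<psi>)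
  have "s \<le> sem \<pi>1 \<phi> \<beta>" if "s \<le> sem \<pi>0 \<phi> \<alpha>"
    by (rule Or.IH(1)[of m c d f \<alpha> \<beta>]) (use Or.prems that in auto)
  moreover have "s \<le> sem \<pi>1 \<psi> \<beta>" if "s \<le> sem \<pi>0 \<psi> \<alpha>"
    by (rule Or.IH(2)[of m c d f \<alpha> \<beta>]) (use Or.prems that in auto)
  ultimately show ?case using Or.prems(5) by (auto simp: idc_le_add_iff[OF assms(1)])
next
  case (Ex x \<phi>)
  have len: "length c = length d"
    using bf_imp_win_cond[OF Ex.prems(1)] by (simp add: win_cond_alt same_eq_pattern_def)
  obtain k where m: "m = Suc k" using Ex.prems(3) by (cases m) auto
  obtain e where e: "s \<le> sem \<pi>0 \<phi> (\<alpha>(x := e))"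
    using Ex.prems(5) unfolding le_sem_Ex_iff[OF assms(1)] ..
  obtain e' where e': "bf \<tau> ar s \<pi>0 \<pi>1 k (c @ [e]) (d @ [e'])"
    using Ex.prems(1) unfolding m back_forth.simps by blast
  have "s \<le> sem \<pi>1 \<phi> (\<beta>(x := e'))"
  proof (rule Ex.IH[OF e' _ _ _ e])
    \<comment> \<open>The bound variable \<open>x\<close> is redirected to the new last position,
      whatever it denoted before; the other free variables keep their positions.\<close>
    show "(f(x := length c)) z < length (c @ [e]) \<and> (\<alpha>(x := e)) z = (c @ [e]) ! (f(x := length c)) z \<and>
        (\<beta>(x := e')) z = (d @ [e']) ! (f(x := length c)) z" if "z \<in> fv \<phi>" for z
      using Ex.prems(4)[of z] that len by (auto simp: nth_append)
  qed (use Ex.prems m in auto)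
  then show ?case unfolding le_sem_Ex_iff[OF assms(1)] ..
next
  case (All x \<phi>)
  have len: "length c = length d"
    using bf_imp_win_cond[OF All.prems(1)] by (simp add: win_cond_alt same_eq_pattern_def)
  obtain k where m: "m = Suc k" using All.prems(3) by (cases m) auto
  show ?case
    unfolding le_sem_All_iff
  proof
    fix e'
    \<comment> \<open>The back condition answers \<open>e'\<close> by some \<open>e\<close>, at
      which the universal hypothesis in \<open>\<pi>0\<close> is then instantiated.\<close>
    obtain e where e: "bf \<tau> ar s \<pi>0 \<pi>1 k (c @ [e]) (d @ [e'])"
      using All.prems(1) unfolding m back_forth.simps by blast
    have le: "s \<le> sem \<pi>0 \<phi> (\<alpha>(x := e))" using All.prems(5) unfolding le_sem_All_iff ..
    show "s \<le> sem \<pi>1 \<phi> (\<beta>(x := e'))"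
    proof (rule All.IH[OF e _ _ _ le])
      show "(f(x := length c)) z < length (c @ [e]) \<and> (\<alpha>(x := e)) z = (c @ [e]) ! (f(x := length c)) z \<and>
          (\<beta>(x := e')) z = (d @ [e']) ! (f(x := length c)) z" if "z \<in> fv \<phi>" for z
        using All.prems(4)[of z] that len by (auto simp: nth_append)
    qed (use All.prems m in auto)
  qed
qed

lemma bf_preserves_le_val:
  assumes "s \<in> idc" "bf \<tau> ar s \<pi>0 \<pi>1 m c d" "wf_fm \<tau> ar \<phi>" "qr \<phi> \<le> m" "fv \<phi> \<subseteq> {..<length c}"
    and "s \<le> val \<pi>0 \<phi> c"
  shows "s \<le> val \<pi>1 \<phi> d"
  unfolding val_def
  by (rule bf_preserves_le_sem[OF assms(1-4), of "\<lambda>x. x" "(!) c"])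
     (use assms(5,6) in \<open>auto simp: val_def\<close>)

section \<open>Back-and-forth and equality of values\<close>

text \<open>From left to right, each tuple lies above \<open>s\<close> on its own characteristic
  formula, and equality of values carries this to the other tuple. Conversely, preservation in both
  directions puts the same indecomposables below both values, which are therefore equal.\<close>

lemma equiv_upto_iff_bf:
  fixes \<pi>A :: "('r, 'a, 's::{lattice_semiring,finite}) interp" and \<pi>B :: "('r, 'b, 's) interp"
  assumes "finite \<tau>" "length a = length b"
  shows "equiv_upto \<tau> ar m \<pi>A a \<pi>B b \<longleftrightarrow>
    (\<forall>s\<in>idc. bf \<tau> ar s \<pi>A \<pi>B m a b \<and> bf \<tau> ar s \<pi>B \<pi>A m b a)"
proof
  assume eq: "equiv_upto \<tau> ar m \<pi>A a \<pi>B b"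
  have self: "s \<le> val \<pi> (char_fm \<tau> ar \<pi> s m c) c"
    if "s \<in> idc" for s :: 's and \<pi> :: "('r, 'c, 's) interp" and c
    unfolding le_val_char_fm_iff_bf[OF assms(1) that refl]
    by (rule back_forth_refl) (simp add: win_cond_alt same_eq_pattern_def)
  \<comment> \<open>The universe \<open>'c\<close> is arbitrary, so this covers the characteristic
    formulae of both interpretations.\<close>
  have val_eq: "val \<pi>A (char_fm \<tau> ar \<pi> s m c) a = val \<pi>B (char_fm \<tau> ar \<pi> s m c) b"
    if "length c = length a" for s :: 's and \<pi> :: "('r, 'c, 's) interp" and c
    using eq wf_fm_char_fm[OF assms(1), of ar \<pi> s m c] fv_char_fm[OF assms(1), of ar \<pi> s m c]
      qr_char_fm_le[OF assms(1), of ar \<pi> s m c] that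
    by (simp add: equiv_upto_def)
  show "\<forall>s\<in>idc. bf \<tau> ar s \<pi>A \<pi>B m a b \<and> bf \<tau> ar s \<pi>B \<pi>A m b a"
  proof (intro ballI conjI)
    fix s :: 's assume s: "s \<in> idc"
    show "bf \<tau> ar s \<pi>A \<pi>B m a b"
      using self[OF s, of \<pi>A a] le_val_char_fm_iff_bf[OF assms(1) s assms(2)]
      by (simp add: val_eq)
    show "bf \<tau> ar s \<pi>B \<pi>A m b a"
      using self[OF s, of \<pi>B b] le_val_char_fm_iff_bf[OF assms(1) s assms(2)[symmetric]]
      by (simp add: val_eq[symmetric] assms(2))
  qed
next
  assume bf: "\<forall>s\<in>idc. bf \<tau> ar s \<pi>A \<pi>B m a b \<and> bf \<tau> ar s \<pi>B \<pi>A m b a"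
  show "equiv_upto \<tau> ar m \<pi>A a \<pi>B b"
    unfolding equiv_upto_def
  proof (intro allI impI, elim conjE)
    fix \<phi> assume \<phi>: "wf_fm \<tau> ar \<phi>" "fv \<phi> \<subseteq> {..<length a}" "qr \<phi> \<le> m"
    show "val \<pi>A \<phi> a = val \<pi>B \<phi> b"
    proof (rule eq_if_idc_le_iff)
      fix s :: 's assume s: "s \<in> idc"
      show "s \<le> val \<pi>A \<phi> a \<longleftrightarrow> s \<le> val \<pi>B \<phi> b"
        using bf_preserves_le_val[OF s, of \<tau> ar \<pi>A \<pi>B m a b \<phi>]
          bf_preserves_le_val[OF s, of \<tau> ar \<pi>B \<pi>A m b a \<phi>] bf s \<phi> assms(2)
        by auto
    qed
  qed
qed

theorem theorem5p11:
  fixes \<tau> :: "'r set" and ar :: "'r \<Rightarrow> nat"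
    and \<pi>A :: "('r, 'a, 's::{lattice_semiring,finite}) interp"
    and \<pi>B :: "('r, 'b, 's) interp"
    and a :: "'a list" and b :: "'b list"
    and n m :: nat
  assumes "finite \<tau>"
    and "length a = n" and "length b = n"
  shows
    "(duplicator_wins_HG \<tau> ar m \<pi>A a \<pi>B b \<longleftrightarrow>
       (\<forall>s \<in> idc.
          val \<pi>B (char_fm \<tau> ar \<pi>A s m a) b + s = val \<pi>B (char_fm \<tau> ar \<pi>A s m a) b \<and>
          val \<pi>A (char_fm \<tau> ar \<pi>B s m b) a + s = val \<pi>A (char_fm \<tau> ar \<pi>B s m b) a)) \<and>
     ((\<forall>s \<in> idc.
          val \<pi>B (char_fm \<tau> ar \<pi>A s m a) b + s = val \<pi>B (char_fm \<tau> ar \<pi>A s m a) b \<and>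
          val \<pi>A (char_fm \<tau> ar \<pi>B s m b) a + s = val \<pi>A (char_fm \<tau> ar \<pi>B s m b) a) \<longleftrightarrow>
       equiv_upto \<tau> ar m \<pi>A a \<pi>B b) \<and>
     game_sound
       (duplicator_wins_HG \<tau> ar m ::
          ('r, 'a, 's) interp \<Rightarrow> 'a list \<Rightarrow> ('r, 'b, 's) interp \<Rightarrow> 'b list \<Rightarrow> bool)
       (equiv_upto \<tau> ar m) \<and>
     game_complete
       (duplicator_wins_HG \<tau> ar m ::
          ('r, 'a, 's) interp \<Rightarrow> 'a list \<Rightarrow> ('r, 'b, 's) interp \<Rightarrow> 'b list \<Rightarrow> bool)
       (equiv_upto \<tau> ar m)"
proof -
  have len: "length a = length b" using assms by simp
  \<comment> \<open>Stated for arbitrary interpretations and tuples, because soundness and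
    completeness quantify over all of them.\<close>
  have "duplicator_wins_HG \<tau> ar m \<pi> c \<pi>' d \<longleftrightarrow> equiv_upto \<tau> ar m \<pi> c \<pi>' d"
    if "length c = length d"
    for \<pi> :: "('r, 'a, 's) interp" and c and \<pi>' :: "('r, 'b, 's) interp" and d
    unfolding duplicator_wins_iff_bf equiv_upto_iff_bf[OF assms(1) that] ..
  then show ?thesis
    using le_val_char_fm_iff_bf[OF assms(1) _ len, of _ \<pi>B ar \<pi>A m]
      le_val_char_fm_iff_bf[OF assms(1) _ len[symmetric], of _ \<pi>A ar \<pi>B m]
      equiv_upto_iff_bf[OF assms(1) len, of ar m \<pi>A \<pi>B]
      duplicator_wins_iff_bf[of \<tau> ar m \<pi>A a \<pi>B b]
    by (simp add: add_eq_left_iff_le game_sound_def game_complete_def)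
qed

end
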